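(* For every traditional syllogism $P_1,P_2\therefore C$ and every traditional strengthened syllogism $P_1,P_2,\mathbf{I}_{XX}\therefore C$ ($X\in\{S,M,P\}$), the corresponding sequent of categorical formulas ($P_1^{*},P_2^{*}\vdash C^{*}$, resp. $P_1^{*},P_2^{*},X\otimes X\vdash C^{*}$) is provable in $\mathrm{RLL}^{\bot}$ if and only if the corresponding diagrammatic sequent ($P_1^{\circ},P_2^{\circ}\models C^{\circ}$, resp. $P_1^{\circ},P_2^{\circ},X\leftarrow\bullet\rightarrow X\models C^{\circ}$) is provable in $\mathrm{SYLL}^{+}$.
   Context: $\mathrm{RLL}^{\bot}$: formulas built from atoms (including a distinguished atom $\bot$) by $\otimes$ and $\multimap$; sequents $\Gamma\vdash A$ with $\Gamma$ a finite multiset; rules exactly (Id) $A\vdash A$; ($\otimes$L) from $\Gamma,A,B\vdash C$ infer $\Gamma,A\otimes B\vdash C$; ($\otimes$R) from $\Gamma\vdash A$, $\Delta\vdash B$ infer $\Gamma,\Delta\vdash A\otimes B$; ($\multimap$L) from $\Gamma\vdash A$, $\Delta,B\vdash C$ infer $\Gamma,\Delta,A\multimap B\vdash C$; ($\multimap$R) from $\Gamma,A\vdash B$ infer $\Gamma\vdash A\multimap B$ (no cut, weakening or contraction). $A^{\bot}:=A\multimap\bot$. The term-variables $S,M,P$ are read as three distinct atoms other than $\bot$. Traditional syllogistics: for upper-case term-variables $A,B$ (lower case $b$ = non-$B$) the categorical propositions are $\mathbf{A}_{AB}$ (Each $A$ is $B$), $\mathbf{A}_{Ab}$ (Each $A$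 is non-$B$), $\mathbf{I}_{AB}$ (Some $A$ is $B$), $\mathbf{I}_{Ab}$ (Some $A$ is non-$B$). A traditional syllogism is $P_1,P_2\therefore C$ of categorical propositions in $S,M,P$ with $M$ in both premises and not in $C$, $P$ in $P_1$, $S$ in $P_2$, and $C$ with subject $S$ and predicate $P$ (possibly as $p$); a strengthened one adds the premise $\mathbf{I}_{XX}$, $X\in\{S,M,P\}$. Translations: $\mathbf{A}_{AB}^{*}=A\multimap B$, $\mathbf{A}_{Ab}^{*}=A\multimap B^{\bot}$, $\mathbf{I}_{AB}^{*}=A\otimes B$, $\mathbf{I}_{Ab}^{*}=A\otimes B^{\bot}$; and the syllogistic diagrams $\mathbf{A}_{AB}^{\circ}=A\rightarrow B$, $\mathbf{A}_{Ab}^{\circ}=A\rightarrow\bullet\leftarrow B$, $\mathbf{I}_{AB}^{\circ}=A\leftarrow\bullet\rightarrow B$, $\mathbf{I}_{Ab}^{\circ}=A\leftarrow\bullet\rightarrow\bullet\leftarrow B$. The diagrammatic system $\mathrm{SYLL}^{+}$. A diagram is a finite string $x_0r_1x_1\cdots r_nx_n$ ($n\ge0$) with each $r_i\in\{\rightarrow,\leftarrow\}$, each $x_i$ either the bullet $\bullet$ or a term-variable, and $x_0,x_n$ term-variables. The reversal of a diagram is obtained by reading it backwards and swapping $\rightarrow$ with $\leftarrow$. Well-formed diagrams: syllogistic diagrams, their reversals, and concatenations $\mathcal{D}A\mathcal{E}$ of well-formed diagrams $\mathcal{D}A$ and $A\mathcal{E}$ (overlapping the common extremal term-variable $A$). Rules: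 (reversal) from a syllogistic diagram infer its reversal and conversely; (concatenation) from $\mathcal{D}A$ and $A\mathcal{E}$, given in either order, infer $\mathcal{D}A\mathcal{E}$; (composition) from $\mathcal{D}\rightarrow A\rightarrow\mathcal{E}$ infer $\mathcal{D}\rightarrow\mathcal{E}$, and from $\mathcal{D}\leftarrow A\leftarrow\mathcal{E}$ infer $\mathcal{D}\leftarrow\mathcal{E}$ ($A$ a term-variable, $\mathcal{D},\mathcal{E}$ the remaining parts); (existential import axiom) infer $A\leftarrow\bullet\rightarrow A$ from no premises, for any term-variable $A$. A sequent $\mathcal{G}_1,\ldots,\mathcal{G}_n\models\mathcal{C}$ of well-formed diagrams is provable if there is a finite tree of well-formed diagrams with root $\mathcal{C}$, whose leaves are the $\mathcal{G}_i$ (or instances of the axiom), and each branching an instance of a rule.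
   Formalization: Every leaf, including each instance of the existential import axiom, must be listed in the diagrammatic sequent and used exactly once; if axiom instances could stay unlisted, M→P, M→S ⊨ S←•→P would be provable although M⊸P, M⊸S ⊢ S⊗P is not. *)

theory Defs
  imports "HOL-Library.Multiset"
begin

section \<open>The calculus RLL with a distinguished atom\<close>

text \<open>The atoms are \<open>Bot\<close> and \<open>Atom a\<close>; in particular \<open>Bot\<close> differs from every \<open>Atom a\<close>.\<close>

datatype 'v formula =
    Atom 'v
  | Bot
  | Tensor "'v formula" "'v formula"  (infixr "\<otimes>" 70)
  | Lolli "'v formula" "'v formula"  (infixr "-\<circ>" 65)

definition lneg :: "'v formula \<Rightarrow> 'v formula" where
  "lneg A = (A -\<circ> Bot)"

inductive rll :: "'v formula multiset \<Rightarrow> 'v formula \<Rightarrow> bool"  (infix "\<turnstile>" 50) where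
  Id: "{#A#} \<turnstile> A"
| TensorL: "\<Gamma> + {#A, B#} \<turnstile> C \<Longrightarrow> \<Gamma> + {#A \<otimes> B#} \<turnstile> C"
| TensorR: "\<Gamma> \<turnstile> A \<Longrightarrow> \<Delta> \<turnstile> B \<Longrightarrow> \<Gamma> + \<Delta> \<turnstile> A \<otimes> B"
| LolliL: "\<Gamma> \<turnstile> A \<Longrightarrow> \<Delta> + {#B#} \<turnstile> C \<Longrightarrow> \<Gamma> + \<Delta> + {#A -\<circ> B#} \<turnstile> C"
| LolliR: "\<Gamma> + {#A#} \<turnstile> B \<Longrightarrow> \<Gamma> \<turnstile> A -\<circ> B"


section \<open>Categorical propositions and traditional syllogisms\<close>

datatype 'v categorical =
    Each_is 'v 'v
  | Each_is_non 'v 'v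
  | Some_is 'v 'v
  | Some_is_non 'v 'v

fun subject :: "'v categorical \<Rightarrow> 'v" where
  "subject (Each_is A B) = A"
| "subject (Each_is_non A B) = A"
| "subject (Some_is A B) = A"
| "subject (Some_is_non A B) = A"

text \<open>The term-variable of the predicate, whether or not the predicate is complemented.\<close>

fun predicate :: "'v categorical \<Rightarrow> 'v" where
  "predicate (Each_is A B) = B"
| "predicate (Each_is_non A B) = B"
| "predicate (Some_is A B) = B"
| "predicate (Some_is_non A B) = B"

definition terms :: "'v categorical \<Rightarrow> 'v set" where
  "terms Q = {subject Q, predicate Q}"

definition traditional_syllogism ::
  "'v \<Rightarrow> 'v \<Rightarrow> 'v \<Rightarrow> 'v categorical \<Rightarrow> 'v categorical \<Rightarrow> 'v categorical \<Rightarrow> bool" where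
  "traditional_syllogism S M P P1 P2 C \<longleftrightarrow>
     terms P1 \<subseteq> {S, M, P} \<and> terms P2 \<subseteq> {S, M, P} \<and> terms C \<subseteq> {S, M, P} \<and>
     M \<in> terms P1 \<and> M \<in> terms P2 \<and> M \<notin> terms C \<and>
     P \<in> terms P1 \<and> S \<in> terms P2 \<and>
     subject C = S \<and> predicate C = P"

fun formula_of :: "'v categorical \<Rightarrow> 'v formula" where
  "formula_of (Each_is A B) = Atom A -\<circ> Atom B"
| "formula_of (Each_is_non A B) = Atom A -\<circ> lneg (Atom B)"
| "formula_of (Some_is A B) = Atom A \<otimes> Atom B"
| "formula_of (Some_is_non A B) = Atom A \<otimes> lneg (Atom B)"


section \<open>Diagrams and the system SYLL+\<close>

datatype arrow = To  ("\<rightarrow>") | From  ("\<leftarrow>")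

datatype 'v node = Bullet  ("\<bullet>") | Term 'v

text \<open>
  The string $x_0 r_1 x_1 \cdots r_n x_n$ is encoded as the pair of its first node \<open>x\<^sub>0\<close> and the
  list of the pairs \<open>(r\<^sub>i, x\<^sub>i)\<close>. That the extremal nodes are term-variables is not part of the
  type; it holds for all well-formed diagrams below.
\<close>

type_synonym 'v diagram = "'v node \<times> (arrow \<times> 'v node) list"

fun last_node :: "'v diagram \<Rightarrow> 'v node" where
  "last_node (x, rs) = (if rs = [] then x else snd (last rs))"

fun swap_arrow :: "arrow \<Rightarrow> arrow" where
  "swap_arrow \<rightarrow> = \<leftarrow>"
| "swap_arrow \<leftarrow> = \<rightarrow>"

fun reversal :: "'v diagram \<Rightarrow> 'v diagram" where
  "reversal (x, []) = (x, [])"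
| "reversal (x, (r, y) # rs) =
     (fst (reversal (y, rs)), snd (reversal (y, rs)) @ [(swap_arrow r, x)])"

text \<open>Meant for \<open>last_node D = fst E\<close>: the common extremal node is overlapped.\<close>

definition concatenation :: "'v diagram \<Rightarrow> 'v diagram \<Rightarrow> 'v diagram" where
  "concatenation D E = (fst D, snd D @ snd E)"

fun diagram_of :: "'v categorical \<Rightarrow> 'v diagram" where
  "diagram_of (Each_is A B) = (Term A, [(\<rightarrow>, Term B)])"
| "diagram_of (Each_is_non A B) = (Term A, [(\<rightarrow>, \<bullet>), (\<leftarrow>, Term B)])"
| "diagram_of (Some_is A B) = (Term A, [(\<leftarrow>, \<bullet>), (\<rightarrow>, Term B)])"
| "diagram_of (Some_is_non A B) = (Term A, [(\<leftarrow>, \<bullet>), (\<rightarrow>, \<bullet>), (\<leftarrow>, Term B)])"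

definition syllogistic :: "'v diagram \<Rightarrow> bool" where
  "syllogistic D \<longleftrightarrow> (\<exists>Q. D = diagram_of Q)"

inductive well_formed :: "'v diagram \<Rightarrow> bool" where
  "syllogistic D \<Longrightarrow> well_formed D"
| "syllogistic D \<Longrightarrow> well_formed (reversal D)"
| "well_formed D \<Longrightarrow> well_formed E \<Longrightarrow> last_node D = Term A \<Longrightarrow> fst E = Term A \<Longrightarrow>
     well_formed (concatenation D E)"

text \<open>
  \<open>\<G> \<Turnstile> C\<close> holds iff there is a finite proof tree of well-formed diagrams with root \<open>C\<close> whose
  multiset of leaves is \<open>\<G>\<close>. Leaves are not shared or discarded, as in RLL. An instance of the
  existential import axiom is a leaf as well and hence is listed in the sequent; this is how the
  premise \<open>X \<leftarrow>\<bullet>\<rightarrow> X\<close> of a strengthened syllogism is used. (Were axiom leaves omitted from the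
  sequent, then \<open>M \<rightarrow> P, M \<rightarrow> S \<Turnstile> S \<leftarrow>\<bullet>\<rightarrow> P\<close> would hold, although the corresponding RLL sequent
  \<open>M -\<circ> P, M -\<circ> S \<turnstile> S \<otimes> P\<close> is not provable.) As multiset union is commutative, one
  concatenation rule covers both orders of its premises.
\<close>

inductive syll_plus :: "'v diagram multiset \<Rightarrow> 'v diagram \<Rightarrow> bool"  (infix "\<Turnstile>" 50) where
  premise: "well_formed D \<Longrightarrow> {#D#} \<Turnstile> D"
| existential_import:
    "{#(Term A, [(\<leftarrow>, \<bullet>), (\<rightarrow>, Term A)])#} \<Turnstile> (Term A, [(\<leftarrow>, \<bullet>), (\<rightarrow>, Term A)])"
| reversal: "\<G> \<Turnstile> D \<Longrightarrow> syllogistic D \<Longrightarrow> \<G> \<Turnstile> reversal D"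
| reversal_converse: "\<G> \<Turnstile> reversal D \<Longrightarrow> syllogistic D \<Longrightarrow> \<G> \<Turnstile> D"
| concatenation:
    "\<G> \<Turnstile> D \<Longrightarrow> \<H> \<Turnstile> E \<Longrightarrow> last_node D = Term A \<Longrightarrow> fst E = Term A \<Longrightarrow>
     \<G> + \<H> \<Turnstile> concatenation D E"
| composition_right:
    "\<G> \<Turnstile> (x, rs @ [(\<rightarrow>, Term A), (\<rightarrow>, y)] @ ss) \<Longrightarrow> well_formed (x, rs @ [(\<rightarrow>, y)] @ ss) \<Longrightarrow>
     \<G> \<Turnstile> (x, rs @ [(\<rightarrow>, y)] @ ss)"
| composition_left:
    "\<G> \<Turnstile> (x, rs @ [(\<leftarrow>, Term A), (\<leftarrow>, y)] @ ss) \<Longrightarrow> well_formed (x, rs @ [(\<leftarrow>, y)] @ ss) \<Longrightarrow>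
     \<G> \<Turnstile> (x, rs @ [(\<leftarrow>, y)] @ ss)"

end

(*
  In both systems every premise is used exactly once. Reading tensor as addition and A -o B as
  B - A in an abelian group, and a diagram as the sum over its arrows of target minus source, every
  provable sequent is balanced: its premises add up to its conclusion. A balanced (strengthened)
  syllogism is one of the classical moods, and these are provable in both systems. So provability
  on either side amounts to balance.
*)

theory Submission
  imports Defs
begin

section \<open>Balance\<close>

fun formula_weight :: "('v \<Rightarrow> 'a::ab_group_add) \<Rightarrow> 'a \<Rightarrow> 'v formula \<Rightarrow> 'a" where
  "formula_weight w b (Atom a) = w a"
| "formula_weight w b Bot = b + b"
| "formula_weight w b (A \<otimes> B) = formula_weight w b A + formula_weight w b B"
| "formula_weight w b (A -\<circ> B) = formula_weight w b B - formula_weight w b A"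

lemma rll_balanced:
  assumes "\<Gamma> \<turnstile> A"
  shows "(\<Sum>F\<in>#\<Gamma>. formula_weight w b F) = formula_weight w b A"
  using assms by induction (auto simp: algebra_simps)

text \<open>At a bullet that is a source only the two arrow heads contribute, as the factors of a
  tensor product do.\<close>

fun source_weight :: "('v \<Rightarrow> 'a::ab_group_add) \<Rightarrow> 'v node \<Rightarrow> 'a" where
  "source_weight w \<bullet> = 0"
| "source_weight w (Term a) = w a"

text \<open>
  A bullet that is the target of arrows is so from both sides, hence \<open>Bot\<close> weighs \<open>b + b\<close> and
  each arrow into a bullet contributes \<open>b\<close>.
\<close>

fun target_weight :: "('v \<Rightarrow> 'a::ab_group_add) \<Rightarrow> 'a \<Rightarrow> 'v node \<Rightarrow> 'a" where
  "target_weight w b \<bullet> = b"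
| "target_weight w b (Term a) = w a"

fun step_weight :: "('v \<Rightarrow> 'a::ab_group_add) \<Rightarrow> 'a \<Rightarrow> 'v node \<Rightarrow> arrow \<Rightarrow> 'v node \<Rightarrow> 'a" where
  "step_weight w b x \<rightarrow> y = target_weight w b y - source_weight w x"
| "step_weight w b x \<leftarrow> y = target_weight w b x - source_weight w y"

fun diagram_weight :: "('v \<Rightarrow> 'a::ab_group_add) \<Rightarrow> 'a \<Rightarrow> 'v diagram \<Rightarrow> 'a" where
  "diagram_weight w b (x, []) = 0"
| "diagram_weight w b (x, (r, y) # rs) = step_weight w b x r y + diagram_weight w b (y, rs)"

lemma last_node_Cons: "last_node (x, (r, y) # rs) = last_node (y, rs)"
  by simp

lemma diagram_weight_append:
  "diagram_weight w b (x, rs @ ss) =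
     diagram_weight w b (x, rs) + diagram_weight w b (last_node (x, rs), ss)"
proof (induction rs arbitrary: x)
  case (Cons p rs)
  then show ?case by (cases p) (simp add: add.assoc last_node_Cons del: last_node.simps)
qed simp

lemma diagram_weight_concatenation:
  assumes "last_node D = fst E"
  shows "diagram_weight w b (concatenation D E) = diagram_weight w b D + diagram_weight w b E"
  using assms by (cases D; cases E) (simp add: concatenation_def diagram_weight_append del: last_node.simps)

text \<open>A step is weighed by the source and target of its arrow, not by the reading direction,
  and the sum is commutative.\<close>

lemma diagram_weight_reversal: "diagram_weight w b (reversal D) = diagram_weight w b D"
proof -
  have last: "last_node (reversal D) = fst D" for D :: "'b diagram"
    by (induction D rule: reversal.induct) auto
  have step: "step_weight w b y (swap_arrow r) x = step_weight w b x r y" for x y r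
    by (cases r) auto
  show ?thesis
  proof (induction D rule: reversal.induct)
    case (2 x r y rs)
    then show ?case
      using last[of "(y, rs)"]
      by (simp add: diagram_weight_append step add.commute del: last_node.simps)
  qed simp
qed

lemma syll_plus_balanced:
  assumes "\<G> \<Turnstile> D"
  shows "(\<Sum>E\<in>#\<G>. diagram_weight w b E) = diagram_weight w b D"
  using assms
proof induction
  case (composition_right \<G> x rs A y ss)
  \<comment> \<open>\<open>A\<close> is the target of one arrow and the source of the next; a term
    weighs the same in both roles, so its contributions cancel.\<close>
  then show ?case by (simp add: diagram_weight_append del: last_node.simps)
next
  case (composition_left \<G> x rs A y ss)
  then show ?case by (simp add: diagram_weight_append del: last_node.simps)
qed (auto simp: diagram_weight_reversal diagram_weight_concatenation)

text \<open>Makes the balance conditions of the two systems coincide: the two arrows into a bullet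
  together contribute the weight \<open>b + b\<close> of \<open>Bot\<close>.\<close>

lemma diagram_weight_diagram_of:
  "diagram_weight w b (diagram_of Q) = formula_weight w b (formula_of Q)"
  by (cases Q) (auto simp: lneg_def)


section \<open>The traditional moods\<close>

text \<open>A calculus to be interpreted in both systems. Its basis is conversion with the four
  moods of the first figure; \<open>Baroco\<close> and \<open>Bocardo\<close> are added since
  conversion does not reduce them to that figure.\<close>

inductive deduces :: "'v categorical multiset \<Rightarrow> 'v categorical \<Rightarrow> bool" where
  assumption: "deduces {#Q#} Q"
| converse_E: "deduces \<Gamma> (Each_is_non A B) \<Longrightarrow> deduces \<Gamma> (Each_is_non B A)"
| converse_I: "deduces \<Gamma> (Some_is A B) \<Longrightarrow> deduces \<Gamma> (Some_is B A)"
| Barbara: "deduces \<Gamma> (Each_is B C) \<Longrightarrow> deduces \<Delta> (Each_is A B) \<Longrightarrow>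
    deduces (\<Gamma> + \<Delta>) (Each_is A C)"
| Celarent: "deduces \<Gamma> (Each_is_non B C) \<Longrightarrow> deduces \<Delta> (Each_is A B) \<Longrightarrow>
    deduces (\<Gamma> + \<Delta>) (Each_is_non A C)"
| Darii: "deduces \<Gamma> (Each_is B C) \<Longrightarrow> deduces \<Delta> (Some_is A B) \<Longrightarrow>
    deduces (\<Gamma> + \<Delta>) (Some_is A C)"
| Ferio: "deduces \<Gamma> (Each_is_non B C) \<Longrightarrow> deduces \<Delta> (Some_is A B) \<Longrightarrow>
    deduces (\<Gamma> + \<Delta>) (Some_is_non A C)"
| Baroco: "deduces \<Gamma> (Each_is C B) \<Longrightarrow> deduces \<Delta> (Some_is_non A B) \<Longrightarrow>
    deduces (\<Gamma> + \<Delta>) (Some_is_non A C)"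
| Bocardo: "deduces \<Gamma> (Some_is_non B C) \<Longrightarrow> deduces \<Delta> (Each_is B A) \<Longrightarrow>
    deduces (\<Gamma> + \<Delta>) (Some_is_non A C)"

section \<open>Moods as diagram derivations\<close>

lemma syllogistic_diagram_of: "syllogistic (diagram_of Q)"
  by (auto simp: syllogistic_def)

lemma well_formed_diagram_of: "well_formed (diagram_of Q)"
  by (rule well_formed.intros(1)[OF syllogistic_diagram_of])

lemma syll_plus_reversal_diagram_of: "\<G> \<Turnstile> diagram_of Q \<Longrightarrow> \<G> \<Turnstile> reversal (diagram_of Q)"
  by (rule reversal[OF _ syllogistic_diagram_of])

text \<open>Concatenation joins two diagrams at the middle term \<open>B\<close>, which composition
  then deletes. The minor premise comes first because diagrams run from subject to
  predicate.\<close>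

lemma deduces_syll_plus:
  assumes "deduces \<Gamma> Q"
  shows "image_mset diagram_of \<Gamma> \<Turnstile> diagram_of Q"
  using assms
proof induction
  case (assumption Q)
  show ?case by (simp add: premise well_formed_diagram_of)
next
  case (converse_E \<Gamma> A B)
  from syll_plus_reversal_diagram_of[OF this(2)] show ?case by simp
next
  case (converse_I \<Gamma> A B)
  from syll_plus_reversal_diagram_of[OF this(2)] show ?case by simp
next
  case (Barbara \<Gamma> B C \<Delta> A)
  let ?\<G> = "image_mset diagram_of (\<Gamma> + \<Delta>)"
  from concatenation[OF Barbara(4,3)] show ?case
    using composition_right[of ?\<G> "Term A" "[]" B "Term C" "[]"]
      well_formed_diagram_of[of "Each_is A C"]
    by (simp add: concatenation_def add.commute)
next
  case (Celarent \<Gamma> B C \<Delta> A)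
  let ?\<G> = "image_mset diagram_of (\<Gamma> + \<Delta>)"
  from concatenation[OF Celarent(4,3)] show ?case
    using composition_right[of ?\<G> "Term A" "[]" B "\<bullet>" "[(\<leftarrow>, Term C)]"]
      well_formed_diagram_of[of "Each_is_non A C"]
    by (simp add: concatenation_def add.commute)
next
  case (Darii \<Gamma> B C \<Delta> A)
  let ?\<G> = "image_mset diagram_of (\<Gamma> + \<Delta>)"
  from concatenation[OF Darii(4,3)] show ?case
    using composition_right[of ?\<G> "Term A" "[(\<leftarrow>, \<bullet>)]" B "Term C" "[]"]
      well_formed_diagram_of[of "Some_is A C"]
    by (simp add: concatenation_def add.commute)
next
  case (Ferio \<Gamma> B C \<Delta> A)
  let ?\<G> = "image_mset diagram_of (\<Gamma> + \<Delta>)"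
  from concatenation[OF Ferio(4,3)] show ?case
    using composition_right[of ?\<G> "Term A" "[(\<leftarrow>, \<bullet>)]" B "\<bullet>" "[(\<leftarrow>, Term C)]"]
      well_formed_diagram_of[of "Some_is_non A C"]
    by (simp add: concatenation_def add.commute)
next
  case (Baroco \<Gamma> C B \<Delta> A)
  let ?\<G> = "image_mset diagram_of (\<Gamma> + \<Delta>)"
  \<comment> \<open>Reversing the universal premise makes both arrows at \<open>B\<close> point
    left, so that \<open>composition_left\<close> applies.\<close>
  have "image_mset diagram_of \<Gamma> \<Turnstile> (Term B, [(\<leftarrow>, Term C)])"
    using syll_plus_reversal_diagram_of[OF Baroco(3)] by simp
  from concatenation[OF Baroco(4) this] show ?case
    using composition_left[of ?\<G> "Term A" "[(\<leftarrow>, \<bullet>), (\<rightarrow>, \<bullet>)]" B "Term C" "[]"]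
      well_formed_diagram_of[of "Some_is_non A C"]
    by (simp add: concatenation_def add.commute)
next
  case (Bocardo \<Gamma> B C \<Delta> A)
  let ?\<G> = "image_mset diagram_of (\<Gamma> + \<Delta>)"
  have "image_mset diagram_of \<Delta> \<Turnstile> (Term A, [(\<leftarrow>, Term B)])"
    using syll_plus_reversal_diagram_of[OF Bocardo(4)] by simp
  from concatenation[OF this Bocardo(3)] show ?case
    using composition_left[of ?\<G> "Term A" "[]" B "\<bullet>" "[(\<rightarrow>, \<bullet>), (\<leftarrow>, Term C)]"]
      well_formed_diagram_of[of "Some_is_non A C"]
    by (simp add: concatenation_def add.commute)
qed

section \<open>Moods as RLL derivations\<close>

definition reduces :: "'v formula multiset \<Rightarrow> 'v formula multiset \<Rightarrow> bool" where
  "reduces \<Gamma> \<Delta> \<longleftrightarrow> (\<forall>\<Theta> A. \<Theta> + \<Delta> \<turnstile> A \<longrightarrow> \<Theta> + \<Gamma> \<turnstile> A)"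

lemma reduces_refl: "reduces \<Gamma> \<Gamma>"
  by (simp add: reduces_def)

text \<open>Does the work of cut on the left-hand side: \<open>\<Theta>\<close> is absorbed into the
  context that \<open>reduces\<close> quantifies over, and the two implications compose.\<close>

lemma reduces_cut:
  assumes "reduces \<Gamma> \<Delta>" and "reduces (\<Theta> + \<Delta>) \<Xi>"
  shows "reduces (\<Theta> + \<Gamma>) \<Xi>"
  using assms unfolding reduces_def by (metis add.assoc)

lemma reduces_rll: "reduces \<Gamma> \<Delta> \<Longrightarrow> \<Delta> \<turnstile> A \<Longrightarrow> \<Gamma> \<turnstile> A"
  unfolding reduces_def by (metis add_0)

lemma reduces_Lolli: "reduces ({#A -\<circ> B#} + {#A#}) {#B#}"
  unfolding reduces_def
proof (intro allI impI)
  fix \<Theta> C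
  assume "\<Theta> + {#B#} \<turnstile> C"
  from LolliL[OF Id this, of A] show "\<Theta> + ({#A -\<circ> B#} + {#A#}) \<turnstile> C"
    by (simp only: ac_simps)
qed

lemma reduces_Tensor: "reduces {#A \<otimes> B#} ({#A#} + {#B#})"
  unfolding reduces_def using TensorL by (fastforce simp: add_mset_commute)

text \<open>
  A reading of the categorical propositions under which the moods compose without cut elimination.
  In the last clause, the multiset \<open>N\<close> stands in for \<open>lneg (Atom B)\<close>.
\<close>

fun yields :: "'v formula multiset \<Rightarrow> 'v categorical \<Rightarrow> bool" where
  "yields \<Gamma> (Each_is A B) \<longleftrightarrow> reduces (\<Gamma> + {#Atom A#}) {#Atom B#}"
| "yields \<Gamma> (Each_is_non A B) \<longleftrightarrow> reduces (\<Gamma> + {#Atom A#} + {#Atom B#}) {#Bot#}"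
| "yields \<Gamma> (Some_is A B) \<longleftrightarrow> reduces \<Gamma> ({#Atom A#} + {#Atom B#})"
| "yields \<Gamma> (Some_is_non A B) \<longleftrightarrow>
     (\<exists>N. reduces \<Gamma> ({#Atom A#} + N) \<and> reduces (N + {#Atom B#}) {#Bot#})"

lemma yields_formula_of: "yields {#formula_of Q#} Q"
proof (cases Q)
  case (Each_is_non A B)
  have "reduces ({#Atom B#} + ({#Atom A -\<circ> Atom B -\<circ> Bot#} + {#Atom A#})) {#Bot#}"
    by (rule reduces_cut[OF reduces_Lolli]) (simp only: reduces_Lolli add.commute[of "{#Atom B#}"])
  then show ?thesis
    unfolding Each_is_non formula_of.simps yields.simps lneg_def by (simp only: ac_simps)
next
  case (Some_is_non A B)
  then show ?thesis
    using reduces_Tensor[of "Atom A" "lneg (Atom B)"] reduces_Lolli[of "Atom B" Bot]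
    unfolding Some_is_non formula_of.simps yields.simps lneg_def by blast
qed (simp_all only: formula_of.simps yields.simps reduces_Lolli reduces_Tensor)

lemma yields_rll: "yields \<Gamma> Q \<Longrightarrow> \<Gamma> \<turnstile> formula_of Q"
proof (induction \<Gamma> Q rule: yields.induct)
  case (1 \<Gamma> A B)
  then show ?case unfolding formula_of.simps yields.simps by (blast intro: LolliR reduces_rll Id)
next
  case (2 \<Gamma> A B)
  then show ?case
    unfolding formula_of.simps yields.simps lneg_def by (blast intro: LolliR reduces_rll Id)
next
  case (3 \<Gamma> A B)
  then show ?case
    unfolding formula_of.simps yields.simps by (blast intro: TensorR reduces_rll Id)
next
  case (4 \<Gamma> A B)
  then show ?case
    unfolding formula_of.simps yields.simps lneg_def by (blast intro: LolliR TensorR reduces_rll Id)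
qed

lemma deduces_yields:
  assumes "deduces \<Gamma> Q"
  shows "yields (image_mset formula_of \<Gamma>) Q"
  using assms
proof induction
  case (assumption Q)
  show ?case using yields_formula_of by simp
next
  case (converse_E \<Gamma> A B)
  from converse_E(2) show ?case unfolding yields.simps by (simp only: ac_simps)
next
  case (converse_I \<Gamma> A B)
  from converse_I(2) show ?case unfolding yields.simps by (simp only: ac_simps)
next
  case (Barbara \<Gamma> B C \<Delta> A)
  let ?G = "image_mset formula_of \<Gamma>" and ?H = "image_mset formula_of \<Delta>"
  from Barbara(3,4) have "reduces (?G + (?H + {#Atom A#})) {#Atom C#}"
    unfolding yields.simps by (blast intro: reduces_cut)
  then show ?case unfolding yields.simps image_mset_union by (simp only: ac_simps)
next
  case (Celarent \<Gamma> B C \<Delta> A)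
  let ?G = "image_mset formula_of \<Gamma>" and ?H = "image_mset formula_of \<Delta>"
  from Celarent(3) have "reduces ((?G + {#Atom C#}) + {#Atom B#}) {#Bot#}"
    unfolding yields.simps by (simp only: ac_simps)
  with Celarent(4) have "reduces ((?G + {#Atom C#}) + (?H + {#Atom A#})) {#Bot#}"
    unfolding yields.simps by (blast intro: reduces_cut)
  then show ?case unfolding yields.simps image_mset_union by (simp only: ac_simps)
next
  case (Darii \<Gamma> B C \<Delta> A)
  let ?G = "image_mset formula_of \<Gamma>" and ?H = "image_mset formula_of \<Delta>"
  have "reduces ({#Atom A#} + (?G + {#Atom B#})) ({#Atom A#} + {#Atom C#})"
    using Darii(3) reduces_cut reduces_refl unfolding yields.simps by blast
  then have "reduces (?G + ({#Atom A#} + {#Atom B#})) ({#Atom A#} + {#Atom C#})"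
    by (simp only: ac_simps)
  with Darii(4) show ?case
    unfolding yields.simps image_mset_union by (blast intro: reduces_cut)
next
  case (Ferio \<Gamma> B C \<Delta> A)
  let ?G = "image_mset formula_of \<Gamma>" and ?H = "image_mset formula_of \<Delta>"
  \<comment> \<open>The witness for \<open>N\<close> is \<open>?G + {#Atom B#}\<close>: by the
    universal premise, adding \<open>C\<close> to it yields \<open>Bot\<close>.\<close>
  have "reduces (?G + ({#Atom A#} + {#Atom B#})) ({#Atom A#} + (?G + {#Atom B#}))"
    by (simp only: ac_simps reduces_refl)
  with Ferio(4) have "reduces (?G + ?H) ({#Atom A#} + (?G + {#Atom B#}))"
    unfolding yields.simps by (blast intro: reduces_cut)
  with Ferio(3) show ?case unfolding yields.simps image_mset_union by blast
next
  case (Baroco \<Gamma> C B \<Delta> A)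
  let ?G = "image_mset formula_of \<Gamma>" and ?H = "image_mset formula_of \<Delta>"
  from Baroco(4) obtain N where
    N: "reduces ?H ({#Atom A#} + N)" "reduces (N + {#Atom B#}) {#Bot#}"
    by auto
  \<comment> \<open>The new witness is \<open>N + ?G\<close>: \<open>?G\<close> turns an added
    \<open>C\<close> into \<open>B\<close>, with which \<open>N\<close> yields
    \<open>Bot\<close>.\<close>
  have "reduces (?G + ({#Atom A#} + N)) ({#Atom A#} + (N + ?G))"
    by (simp only: ac_simps reduces_refl)
  with N(1) have "reduces (?G + ?H) ({#Atom A#} + (N + ?G))"
    by (blast intro: reduces_cut)
  moreover have "reduces (N + ?G + {#Atom C#}) {#Bot#}"
    using Baroco(3) N(2) unfolding yields.simps add.assoc by (blast intro: reduces_cut)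
  ultimately show ?case unfolding yields.simps image_mset_union by blast
next
  case (Bocardo \<Gamma> B C \<Delta> A)
  let ?G = "image_mset formula_of \<Gamma>" and ?H = "image_mset formula_of \<Delta>"
  from Bocardo(3) obtain N where
    N: "reduces ?G ({#Atom B#} + N)" "reduces (N + {#Atom C#}) {#Bot#}"
    by auto
  \<comment> \<open>The witness \<open>N\<close> is kept; only the \<open>B\<close> next to it is
    turned into \<open>A\<close>.\<close>
  have "reduces (N + (?H + {#Atom B#})) ({#Atom A#} + N)"
    using Bocardo(4) reduces_refl[of "N + {#Atom A#}"] reduces_cut
    unfolding yields.simps add.commute[of "{#Atom A#}" N] by blast
  then have "reduces (?H + ({#Atom B#} + N)) ({#Atom A#} + N)"
    by (simp only: ac_simps)
  with N(1) have "reduces (?G + ?H) ({#Atom A#} + N)"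
    unfolding add.commute[of ?G] by (blast intro: reduces_cut)
  with N(2) show ?case unfolding yields.simps image_mset_union by blast
qed

lemma deduces_rll: "deduces \<Gamma> Q \<Longrightarrow> image_mset formula_of \<Gamma> \<turnstile> formula_of Q"
  by (rule yields_rll[OF deduces_yields])


section \<open>Balanced syllogisms are instances of the moods\<close>

lemma Camestres:
  assumes "deduces \<Gamma> (Each_is C B)" "deduces \<Delta> (Each_is_non A B)"
  shows "deduces (\<Gamma> + \<Delta>) (Each_is_non A C)"
  using converse_E[OF Celarent[OF converse_E[OF assms(2)] assms(1)]] by (simp add: add.commute)

lemma Disamis:
  assumes "deduces \<Gamma> (Some_is B C)" "deduces \<Delta> (Each_is B A)"
  shows "deduces (\<Gamma> + \<Delta>) (Some_is A C)"
  using converse_I[OF Darii[OF assms(2) converse_I[OF assms(1)]]] by (simp add: add.commute)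

text \<open>The existential premise starts the chain: two uses of \<open>Darii\<close> turn its
  second \<open>A\<close> into \<open>B\<close> and then into \<open>C\<close>.\<close>

lemma Barbari:
  assumes "deduces \<Gamma> (Each_is B C)" "deduces \<Delta> (Each_is A B)" "deduces \<Theta> (Some_is A A)"
  shows "deduces (\<Gamma> + \<Delta> + \<Theta>) (Some_is A C)"
  using Darii[OF assms(1) Darii[OF assms(2,3)]] by (simp add: add.assoc)

lemma Bramantip:
  assumes "deduces \<Gamma> (Each_is C B)" "deduces \<Delta> (Each_is B A)" "deduces \<Theta> (Some_is C C)"
  shows "deduces (\<Gamma> + \<Delta> + \<Theta>) (Some_is A C)"
  using converse_I[OF Barbari[OF assms(2,1,3)]] by (simp add: ac_simps)

text \<open>Of the two occurrences of \<open>B\<close> in the existential premise, one is turned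
  into \<open>A\<close> and the other into \<open>C\<close>.\<close>

lemma Darapti:
  assumes "deduces \<Gamma> (Each_is B C)" "deduces \<Delta> (Each_is B A)" "deduces \<Theta> (Some_is B B)"
  shows "deduces (\<Gamma> + \<Delta> + \<Theta>) (Some_is A C)"
  using Darii[OF assms(1) Disamis[OF assms(3,2)]] by (simp add: ac_simps)

lemma Celaront:
  assumes "deduces \<Gamma> (Each_is_non B C)" "deduces \<Delta> (Each_is A B)" "deduces \<Theta> (Some_is A A)"
  shows "deduces (\<Gamma> + \<Delta> + \<Theta>) (Some_is_non A C)"
  using Ferio[OF assms(1) Darii[OF assms(2,3)]] by (simp add: add.assoc)

lemma Camestrop:
  assumes "deduces \<Gamma> (Each_is C B)" "deduces \<Delta> (Each_is_non A B)" "deduces \<Theta> (Some_is A A)"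
  shows "deduces (\<Gamma> + \<Delta> + \<Theta>) (Some_is_non A C)"
  using Ferio[OF Camestres[OF assms(1,2)] assms(3)] .

lemma Felapton:
  assumes "deduces \<Gamma> (Each_is_non B C)" "deduces \<Delta> (Each_is B A)" "deduces \<Theta> (Some_is B B)"
  shows "deduces (\<Gamma> + \<Delta> + \<Theta>) (Some_is_non A C)"
  using Ferio[OF assms(1) Disamis[OF assms(3,2)]] by (simp add: ac_simps)

lemmas moods = Barbara Celarent Camestres Darii Disamis Ferio Baroco Bocardo
lemmas strengthened_moods = Barbari Bramantip Darapti Celaront Camestrop Felapton

text \<open>Covers the classical moods that differ from the listed ones only by a converted premise,
  such as Cesare or Datisi.\<close>

lemma deduces_converse:
  "deduces {#Each_is_non A B#} (Each_is_non B A)" "deduces {#Some_is A B#} (Some_is B A)"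
  by (simp_all add: assumption converse_E converse_I)

text \<open>Distinctness forces the two terms of each premise up to order, which leaves 8 * 8 * 4
  combinations of forms.\<close>

lemma traditional_syllogism_shapes:
  fixes S M P :: 'v
  defines "shapes \<equiv> \<lambda>A B :: 'v. {Each_is A B, Each_is_non A B, Some_is A B, Some_is_non A B}"
  assumes "distinct [S, M, P]" and "traditional_syllogism S M P P1 P2 C"
  shows "P1 \<in> shapes M P \<union> shapes P M" and "P2 \<in> shapes S M \<union> shapes M S" and "C \<in> shapes S P"
proof -
  have shapes: "Q \<in> shapes (subject Q) (predicate Q)" for Q
    by (cases Q) (simp_all add: shapes_def)
  have "M \<in> terms P1" "P \<in> terms P1" "M \<noteq> P"
    using assms by (simp_all add: traditional_syllogism_def)
  then show "P1 \<in> shapes M P \<union> shapes P M"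
    using shapes[of P1] by (auto simp: terms_def)
  have "S \<in> terms P2" "M \<in> terms P2" "S \<noteq> M"
    using assms by (simp_all add: traditional_syllogism_def)
  then show "P2 \<in> shapes S M \<union> shapes M S"
    using shapes[of P2] by (auto simp: terms_def)
  show "C \<in> shapes S P"
    using shapes[of C] assms by (simp add: traditional_syllogism_def)
qed

context
  fixes S M P :: 'v and w :: "'v \<Rightarrow> int"
  assumes distinct: "distinct [S, M, P]"
    and weights: "w S = 1" "w M = 10" "w P = 100"
begin

text \<open>Checks every combination of forms: the numerical weights refute the unbalanced ones, and
  each survivor is one mood applied to the premises, given or converted.\<close>

lemma balanced_syllogism_deduces:
  assumes "traditional_syllogism S M P P1 P2 C"
    and "formula_weight w 500 (formula_of P1) + formula_weight w 500 (formula_of P2) =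
      formula_weight w 500 (formula_of C)"
  shows "deduces ({#P1#} + {#P2#}) C"
  using assms(2) traditional_syllogism_shapes[OF distinct assms(1)]
  \<comment> \<open>The deleted simplification rules would merge the sum of premises, and the moods
    would no longer match it.\<close>
  by (elim UnE insertE emptyE; hypsubst)
    (simp_all add: lneg_def weights del: union_mset_add_mset_left union_mset_add_mset_right,
      (rule moods; rule assumption deduces_converse)+)

lemma balanced_strengthened_syllogism_deduces:
  assumes "traditional_syllogism S M P P1 P2 C" and "X \<in> {S, M, P}"
    and "formula_weight w 500 (formula_of P1) + formula_weight w 500 (formula_of P2) + (w X + w X) =
      formula_weight w 500 (formula_of C)"
  shows "deduces ({#P1#} + {#P2#} + {#Some_is X X#}) C"
  using assms(2,3) traditional_syllogism_shapes[OF distinct assms(1)]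
  by (elim UnE insertE emptyE; hypsubst)
    (simp_all add: lneg_def weights del: union_mset_add_mset_left union_mset_add_mset_right,
      (rule strengthened_moods; rule assumption deduces_converse)+)

end

theorem mainTheorem2:
  fixes S M P :: 'v
  assumes "distinct [S, M, P]"
  shows "(\<forall>P1 P2 C. traditional_syllogism S M P P1 P2 C \<longrightarrow>
            ({#formula_of P1, formula_of P2#} \<turnstile> formula_of C \<longleftrightarrow>
             {#diagram_of P1, diagram_of P2#} \<Turnstile> diagram_of C)) \<and>
         (\<forall>P1 P2 C. \<forall>X\<in>{S, M, P}. traditional_syllogism S M P P1 P2 C \<longrightarrow>
            ({#formula_of P1, formula_of P2, formula_of (Some_is X X)#} \<turnstile> formula_of C \<longleftrightarrow>
             {#diagram_of P1, diagram_of P2, diagram_of (Some_is X X)#} \<Turnstile> diagram_of C))"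
proof -
  \<comment> \<open>With \<open>Bot\<close> weighing 1000, the difference between premises and conclusion is a number whose
    decimal digits are the coefficients of the atoms. They have absolute value at most 4, so a
    single weight detects balance.\<close>
  define w :: "'v \<Rightarrow> int" where "w = (\<lambda>_. 0)(S := 1, M := 10, P := 100)"
  have weights: "w S = 1" "w M = 10" "w P = 100"
    using assms by (auto simp: w_def)
  \<comment> \<open>By \<open>diagram_weight_diagram_of\<close> either side implies the same balance
    equation; the assumed implication then gives \<open>deduces\<close>, hence the other
    side.\<close>
  have iff: "image_mset formula_of \<Gamma> \<turnstile> formula_of C \<longleftrightarrow> image_mset diagram_of \<Gamma> \<Turnstile> diagram_of C"
    if "(\<Sum>Q\<in>#\<Gamma>. formula_weight w 500 (formula_of Q)) = formula_weight w 500 (formula_of C) \<Longrightarrow>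
      deduces \<Gamma> C" for \<Gamma> C
    using that deduces_rll deduces_syll_plus
      rll_balanced[of "image_mset formula_of \<Gamma>" "formula_of C" w 500]
      syll_plus_balanced[of "image_mset diagram_of \<Gamma>" "diagram_of C" w 500]
    by (auto simp: image_mset.compositionality comp_def diagram_weight_diagram_of)
  show ?thesis
  proof (intro conjI allI ballI impI)
    fix P1 P2 C
    assume "traditional_syllogism S M P P1 P2 C"
    then show "{#formula_of P1, formula_of P2#} \<turnstile> formula_of C \<longleftrightarrow>
        {#diagram_of P1, diagram_of P2#} \<Turnstile> diagram_of C"
      using iff[of "{#P1, P2#}" C] balanced_syllogism_deduces[OF assms weights, of P1 P2 C]
      by (simp add: add_mset_commute)
  next
    fix P1 P2 C X
    assume "X \<in> {S, M, P}" and "traditional_syllogism S M P P1 P2 C"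
    then show "{#formula_of P1, formula_of P2, formula_of (Some_is X X)#} \<turnstile> formula_of C \<longleftrightarrow>
        {#diagram_of P1, diagram_of P2, diagram_of (Some_is X X)#} \<Turnstile> diagram_of C"
      using iff[of "{#P1, P2, Some_is X X#}" C]
        balanced_strengthened_syllogism_deduces[OF assms weights, of P1 P2 C X]
      by (simp add: add_mset_commute add.assoc)
  qed
qed

end
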